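(* Let $K\subset\mathbb{R}^m$ be a convex body such that $0\in\operatorname{int}K$. (a) There exists a continuous map $f_K\colon\mathbb{R}\mathrm{P}^{m-1}\longrightarrow\mathbb{R}^m$ such that, for every integer $k\geq 2$, if $f_K$ admits a $k$-multiplicity, then there exist $k$ pairwise distinct linear hyperplanes $H_1,\ldots,H_k$ in $\mathbb{R}^m$ such that $m(H_1)=\cdots=m(H_k)$. (b) There exists a continuous map $f_K\colon\mathbb{R}\mathrm{P}^{m-1}\longrightarrow\mathbb{R}^m$ such that, for every integer $k\geq 2$, if $f_K$ admits a $k$-multiplicity, then there exist $k$ pairwise distinct linear hyperplanes $H_1,\ldots,H_k$ in $\mathbb{R}^m$ such that $s(H_1)=\cdots=s(H_k)$.
   Context: A convex body in $\mathbb{R}^m$ is a convex compact subset with non-empty interior. A linear hyperplane is a hyperplane through the origin. For a hyperplane $H$ with $H\cap K\neq\emptyset$: $m(H)$ denotes the center of mass of the convex set $K\cap H$ (within $H$; not to be confused with the dimension $m$), and $s(H)$ denotes the Steiner point of $K\cap H$ in $H$, i.e. the center of mass of the Gaussian curvature of the boundary of $K\cap H$ in $H$. Equivalently, identifying $H$ isometrically with $\mathbb{R}^{d}$, $d=m-1$, the Steiner point of a compact convex set $C\subset\mathbb{R}^d$ is $\frac{1}{\kappa_d}\int_{S^{d-1}}h_C(u)\,u\,d\sigma(u)$, where $h_C$ is the support function, $\sigma$ the surface measure on $S^{d-1}$, and $\kappa_d$ the volume of the unit ball of $\mathbb{R}^d$ (and the point itself when $d=0$). A continuous map $f\colon M\to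 N$ admits a $k$-multiplicity if there exist $k$ pairwise distinct points $x_1,\ldots,x_k\in M$ with $f(x_1)=\cdots=f(x_k)$. *)

theory Defs
  imports "HOL-Analysis.Analysis"
begin

definition convex_body :: "'a::euclidean_space set \<Rightarrow> bool" where
  "convex_body K \<longleftrightarrow> convex K \<and> compact K \<and> interior K \<noteq> {}"

definition hyperplane :: "'a::euclidean_space set \<Rightarrow> bool" where
  "hyperplane H \<longleftrightarrow> (\<exists>a b. a \<noteq> 0 \<and> H = {x. a \<bullet> x = b})"

definition linear_hyperplane :: "'a::euclidean_space set \<Rightarrow> bool" where
  "linear_hyperplane H \<longleftrightarrow> hyperplane H \<and> 0 \<in> H"


subsection \<open>Real projective space\<close>

text \<open>
  The projective space of a Euclidean space of dimension \<open>m\<close>, that is \<open>RP\<^sup>m\<^sup>-\<^sup>1\<close> for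
  \<open>\<real>\<^sup>m\<close>: its points are the lines through the origin, and it carries the quotient
  topology of \<open>\<real>\<^sup>m - {0}\<close> under \<open>x \<mapsto> span {x}\<close>.
\<close>

definition projective_space :: "'a::euclidean_space set topology" where
  "projective_space = topology (\<lambda>U. U \<subseteq> (\<lambda>x. span {x}) ` (- {0}) \<and>
      openin (top_of_set (- {0})) {x \<in> - {0}. span {x} \<in> U})"

lemma openin_projective_space:
  "openin projective_space (U :: 'a::euclidean_space set set) \<longleftrightarrow>
    U \<subseteq> (\<lambda>x. span {x}) ` (- {0}) \<and> openin (top_of_set (- {0})) {x \<in> - {0}. span {x} \<in> U}"
proof -
  let ?T = "\<lambda>U :: 'a set set. U \<subseteq> (\<lambda>x. span {x}) ` (- {0}) \<and>
      openin (top_of_set (- {0})) {x \<in> - {0}. span {x} \<in> U}"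
  have "istopology ?T"
    unfolding istopology_def
  proof (intro conjI allI impI)
    fix S T assume S: "?T S" and T: "?T T"
    have eq: "{x \<in> - {0}. span {x} \<in> S \<inter> T} =
        {x \<in> - {0}. span {x} \<in> S} \<inter> {x \<in> - {0}. span {x} \<in> T}" by blast
    show "openin (top_of_set (- {0})) {x \<in> - {0}. span {x} \<in> S \<inter> T}"
      unfolding eq using S T by (intro openin_Int) simp_all
    show "S \<inter> T \<subseteq> (\<lambda>x. span {x}) ` (- {0})" using S by blast
  next
    fix \<K> assume \<K>: "\<forall>S\<in>\<K>. ?T S"
    have eq: "{x \<in> - {0}. span {x} \<in> \<Union> \<K>} = (\<Union>S\<in>\<K>. {x \<in> - {0}. span {x} \<in> S})"
      by auto
    show "openin (top_of_set (- {0})) {x \<in> - {0}. span {x} \<in> \<Union> \<K>}"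
      unfolding eq by (rule openin_Union) (use \<K> in blast)
    show "\<Union> \<K> \<subseteq> (\<lambda>x. span {x}) ` (- {0})" using \<K> by blast
  qed
  then show ?thesis
    unfolding projective_space_def by (simp only: topology_inverse')
qed

lemma topspace_projective_space:
  "topspace (projective_space :: 'a::euclidean_space set topology) = (\<lambda>x. span {x}) ` (- {0})"
proof (rule antisym)
  show "topspace (projective_space :: 'a set topology) \<subseteq> (\<lambda>x. span {x}) ` (- {0})"
    using openin_topspace[of "projective_space :: 'a set topology"]
    unfolding openin_projective_space by blast
  have eq: "{x \<in> - {0::'a}. span {x} \<in> (\<lambda>x. span {x}) ` (- {0})} = - {0}" by blast
  have "openin projective_space ((\<lambda>x::'a. span {x}) ` (- {0}))"
    unfolding openin_projective_space eq by simp
  then show "(\<lambda>x. span {x}) ` (- {0}) \<subseteq> topspace (projective_space :: 'a set topology)"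
    by (rule openin_subset)
qed

lemma quotient_map_projective_space:
  "quotient_map (top_of_set (- {0})) (projective_space :: 'a::euclidean_space set topology)
    (\<lambda>x. span {x})"
  unfolding quotient_map_def topspace_projective_space openin_projective_space by simp

definition admits_multiplicity :: "'a topology \<Rightarrow> ('a \<Rightarrow> 'b) \<Rightarrow> nat \<Rightarrow> bool" where
  "admits_multiplicity M f k \<longleftrightarrow>
    (\<exists>x :: nat \<Rightarrow> 'a. x ` {1..k} \<subseteq> topspace M \<and> inj_on x {1..k} \<and>
      (\<forall>i\<in>{1..k}. \<forall>j\<in>{1..k}. f (x i) = f (x j)))"


subsection \<open>Lebesgue measure on a linear subspace\<close>

definition orthonormal_basis :: "'a::euclidean_space set \<Rightarrow> 'a set \<Rightarrow> bool" where
  "orthonormal_basis H B \<longleftrightarrow>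
    pairwise orthogonal B \<and> (\<forall>b\<in>B. norm b = 1) \<and> span B = H"

lemma orthonormal_basis_exists: "subspace H \<Longrightarrow> \<exists>B. orthonormal_basis H B"
  unfolding orthonormal_basis_def by (erule orthonormal_basis_subspace) blast

text \<open>
  The \<open>dim H\<close>-dimensional Lebesgue measure carried by a subspace \<open>H\<close>, as a Borel measure on
  the ambient space: the image of Lebesgue measure on \<open>\<real>\<^sup>B\<close> under the isometry
  \<open>f \<mapsto> (\<Sum>b\<in>B. f b *\<^sub>R b)\<close> onto \<open>H\<close>. Lebesgue measure being rotation invariant, the choice
  of \<open>B\<close> is immaterial. For \<open>H = {0}\<close> it is the point mass at the origin.
\<close>

definition subspace_lborel :: "'a::euclidean_space set \<Rightarrow> 'a measure" where
  "subspace_lborel H = (let B = (SOME B. orthonormal_basis H B) in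
     distr (\<Pi>\<^sub>M b\<in>B. (lborel :: real measure)) borel (\<lambda>f. \<Sum>b\<in>B. f b *\<^sub>R b))"

definition center_of_mass :: "'a::euclidean_space measure \<Rightarrow> 'a set \<Rightarrow> 'a" where
  "center_of_mass \<mu> C = (1 / measure \<mu> C) *\<^sub>R (LINT x:C|\<mu>. x)"

definition section_centroid :: "'a::euclidean_space set \<Rightarrow> 'a set \<Rightarrow> 'a" where
  "section_centroid K H = center_of_mass (subspace_lborel H) (K \<inter> H)"


subsection \<open>Steiner point\<close>

definition support_function :: "'a::euclidean_space set \<Rightarrow> 'a \<Rightarrow> real" where
  "support_function C u = (SUP x\<in>C. x \<bullet> u)"

text \<open>
  The surface measure of the unit sphere of \<open>H\<close>, as a Borel measure on the ambient space, in
  polar coordinates: a Borel set \<open>A\<close> of unit vectors of \<open>H\<close> has measure \<open>d\<close> times the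
  \<open>d\<close>-dimensional volume of the cone \<open>{r *\<^sub>R u | r u. 0 < r \<and> r \<le> 1 \<and> u \<in> A}\<close>, where
  \<open>d = dim H\<close>. Here \<open>sgn x = x /\<^sub>R norm x\<close> is the radial projection. For \<open>d = 1\<close> this is the
  counting measure on the two unit vectors.
\<close>

definition sphere_measure :: "'a::euclidean_space set \<Rightarrow> 'a measure" where
  "sphere_measure H = scale_measure (of_nat (dim H))
     (distr (restrict_space (subspace_lborel H) (cball 0 1 - {0})) borel sgn)"

text \<open>The Steiner point of a compact convex subset \<open>C\<close> of the linear subspace \<open>H\<close>, taken in \<open>H\<close>.\<close>

definition steiner_point :: "'a::euclidean_space set \<Rightarrow> 'a set \<Rightarrow> 'a" where
  "steiner_point H C =
    (if dim H = 0 then (THE x. x \<in> C)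
     else (1 / unit_ball_vol (real (dim H))) *\<^sub>R
       (LINT u|sphere_measure H. support_function C u *\<^sub>R u))"

definition section_steiner :: "'a::euclidean_space set \<Rightarrow> 'a set \<Rightarrow> 'a" where
  "section_steiner K H = steiner_point H (K \<inter> H)"

end

(* Both maps send a line L to the centroid, respectively the Steiner point, of the section of K by
   the hyperplane orthogonal to L, so that the content lies in their continuity. An integral over
   the hyperplane orthogonal to a unit vector u is an integral over the slab 0 <= u . y <= 1 of
   the function composed with the orthogonal projection along u. Written so, the measure no longer
   varies with u, and continuity follows by dominated convergence: the exceptional set consists of
   the y projected to the frontier of K, which each ray from the origin meets at most once.
   For Steiner points, the support function of the section is moreover Lipschitz in u. *)
theory Submission
  imports Defs
begin

subsection \<open>Lebesgue measure on hyperplanes\<close>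

text \<open>\<open>subspace_lborel\<close> is built from an orthonormal basis picked by
  \<open>SOME\<close>, and nothing makes this choice vary continuously with the hyperplane, so
  continuity cannot be read off the definition. Adjoining the unit normal \<open>u\<close> to the
  chosen basis gives an orthonormal basis of the whole space, and rotation invariance of Lebesgue
  measure makes the choice disappear. The slab has width one so that integrating out the normal
  coordinate contributes the factor 1; being bounded in the normal direction, it also keeps the
  integrands inside one fixed ball, as domination requires. Sphere integrals fit the same scheme,
  because \<open>sphere_measure\<close> is the radial projection of a measure on the hyperplane. The
  two maps take the hyperplane itself as argument and not a unit normal, so no sign ambiguity has to
  be resolved on projective space.\<close>

text \<open>Preimages of balls are balls of the same radius, and preimages of Borel null sets are
  null. These two facts settle all open sets, in particular the open boxes, which determine
  \<open>lborel\<close>.\<close>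

lemma lborel_distr_orthogonal:
  fixes T :: "'a::euclidean_space \<Rightarrow> 'a"
  assumes T: "orthogonal_transformation T"
  shows "distr lborel borel T = lborel"
proof -
  define S where "S = inv T"
  have bij: "bij T" and S: "orthogonal_transformation S"
    using T orthogonal_transformation_bij orthogonal_transformation_inv S_def by auto
  have TS: "T (S x) = x" "S (T x) = x" for x
    using bij by (simp_all add: S_def bij_is_surj bij_is_inj surj_f_inv_f)
  have [measurable]: "T \<in> borel_measurable borel"
    by (intro borel_measurable_continuous_onI linear_continuous_on)
       (simp add: T linear_linear orthogonal_transformation_linear)
  have ball: "emeasure lborel (T -` ball a r) = emeasure lborel (ball a r)" for a r
  proof -
    have "T -` ball a r = ball (S a) r"
      by (metis TS(2) UNIV_I bij bij_is_surj image_orthogonal_transformation_ball[OF S]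
          bij_vimage_eq_inv_image S_def)
    then show ?thesis
      by (cases "0 \<le> r") (simp_all add: emeasure_ball ball_empty)
  qed
  have null: "emeasure lborel (T -` N) = 0" if "negligible N" "N \<in> sets borel" for N
  proof -
    have "T -` N = S ` N"
      using bij by (simp add: S_def bij_vimage_eq_inv_image)
    then have "negligible (T -` N)"
      by (simp add: S negligible_differentiable_image_negligible linear_imp_differentiable_on
          orthogonal_transformation_linear that)
    moreover have "T -` N \<in> sets lborel"
      using that measurable_sets[of T borel borel N] by simp
    ultimately show ?thesis
      by (auto simp: negligible_iff_null_sets null_sets_completion_iff)
  qed
  have vimage_open: "emeasure lborel (T -` U) = emeasure lborel U" if "open U" for U
  proof -
    txt \<open>By Vitali, \<open>U\<close> is up to a null set a disjoint union of balls.\<close>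
    define K where "K = {(a, r). 0 < r \<and> ball a r \<subseteq> U}"
    have "\<exists>i. i \<in> K \<and> x \<in> ball (fst i) (snd i) \<and> snd i < d" if "x \<in> U" "d > 0" for x d
    proof -
      obtain e where "e > 0" "ball x e \<subseteq> U" using \<open>open U\<close> \<open>x \<in> U\<close> open_contains_ball by blast
      then have "(x, min e (d/2)) \<in> K" using \<open>d > 0\<close> by (auto simp: K_def)
      then show ?thesis using \<open>e > 0\<close> \<open>d > 0\<close> by (intro exI[of _ "(x, min e (d/2))"]) auto
    qed
    then obtain C where C: "countable C" "C \<subseteq> K"
       "pairwise (\<lambda>i j. disjnt (ball (fst i) (snd i)) (ball (fst j) (snd j))) C"
       "negligible(U - (\<Union>i \<in> C. ball (fst i) (snd i)))"
      by (rule Vitali_covering_theorem_balls[of U K fst snd])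
    define V where "V = (\<Union>i \<in> C. ball (fst i) (snd i))"
    define N where "N = U - V"
    have "open V" unfolding V_def by blast
    then have N: "N \<in> sets borel" and V: "V \<in> sets borel" and nN: "negligible N"
      using C that by (auto simp: N_def V_def)
    have U: "U = V \<union> N" "V \<inter> N = {}"
      using C(2) by (fastforce simp: N_def V_def K_def)+
    \<comment> \<open>Stated for any Borel measure because it is applied twice: to the image measure
      and to \<open>lborel\<close>.\<close>
    have *: "emeasure M U = (\<integral>\<^sup>+ i. emeasure M (ball (fst i) (snd i)) \<partial>count_space C) + emeasure M N"
      if "sets M = sets borel" for M
    proof -
      have "emeasure M U = emeasure M V + emeasure M N"
        unfolding U(1) using U(2) N V that by (intro plus_emeasure[symmetric]) auto
      also have "emeasure M V = (\<integral>\<^sup>+ i. emeasure M (ball (fst i) (snd i)) \<partial>count_space C)"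
        unfolding V_def using C that
        by (intro emeasure_UN_countable) (auto simp: disjoint_family_on_def pairwise_def disjnt_def)
      finally show ?thesis .
    qed
    have "emeasure (distr lborel borel T) U = emeasure lborel U"
      using null[OF nN N] nN N that
      by (subst (1 2) *) (auto simp: emeasure_distr ball negligible_iff_null_sets
            null_sets_completion_iff intro!: nn_integral_cong)
    then show ?thesis using that by (simp add: emeasure_distr)
  qed
  show ?thesis
    by (rule lborel_eqI[symmetric]) (simp_all add: emeasure_distr vimage_open[OF open_box])
qed

lemma orthonormal_basis_UNIV_card:
  fixes C :: "'a::euclidean_space set"
  assumes "orthonormal_basis UNIV C"
  shows "finite C" "card C = DIM('a)"
proof -
  have "0 \<notin> C" using assms by (force simp: orthonormal_basis_def)
  then have ind: "independent C"
    using assms pairwise_orthogonal_independent unfolding orthonormal_basis_def by blast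
  then show "finite C" using independent_imp_finite by blast
  show "card C = DIM('a)"
    using ind assms by (metis dim_UNIV dim_eq_card_independent dim_span orthonormal_basis_def)
qed

lemma orthonormal_basis_inner:
  assumes "orthonormal_basis H C" "b \<in> C" "c \<in> C"
  shows "b \<bullet> c = (if b = c then 1 else 0)"
  using assms
  by (auto simp: orthonormal_basis_def pairwise_def orthogonal_def dot_square_norm)

lemma orthonormal_basis_expand:
  fixes C :: "'a::euclidean_space set"
  assumes C: "orthonormal_basis H C" and y: "y \<in> H" and fin: "finite C"
  shows "(\<Sum>b\<in>C. (y \<bullet> b) *\<^sub>R b) = y"
proof -
  have "y \<in> span C" using C y by (simp add: orthonormal_basis_def)
  then obtain q where q: "y = (\<Sum>b\<in>C. q b *\<^sub>R b)"
    using fin by (auto simp: span_finite)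
  have "y \<bullet> c = q c" if "c \<in> C" for c
    using that fin unfolding q
    by (simp add: inner_sum_left orthonormal_basis_inner[OF C _ that] if_distrib cong: if_cong)
  then show ?thesis unfolding q by simp
qed

text \<open>For the standard basis this is how \<open>lborel\<close> arises from a product measure;
  a rotation carries the standard basis to \<open>C\<close> and leaves \<open>lborel\<close>
  unchanged.\<close>

lemma distr_lborel_orthonormal_coordinates:
  fixes C :: "'a::euclidean_space set"
  assumes C: "orthonormal_basis UNIV C"
  shows "distr lborel (\<Pi>\<^sub>M b\<in>C. (lborel :: real measure)) (\<lambda>y. \<lambda>b\<in>C. y \<bullet> b) = (\<Pi>\<^sub>M b\<in>C. lborel)"
proof -
  interpret product_sigma_finite "\<lambda>_::'a. lborel :: real measure" by standard
  have fin: "finite C" and card: "card C = card (Basis :: 'a set)"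
    using orthonormal_basis_UNIV_card[OF C] by auto
  obtain \<phi> where \<phi>: "bij_betw \<phi> (Basis :: 'a set) C"
    using finite_same_card_bij[OF finite_Basis fin] card by auto
  \<comment> \<open>The rotation sending each \<open>e\<close> in \<open>Basis\<close> to
    \<open>\<phi> e\<close>, so that the coordinates of \<open>T x\<close> along \<open>C\<close>
    are the standard coordinates of \<open>x\<close>.\<close>
  define T where "T = (\<lambda>x::'a. \<Sum>e\<in>Basis. (x \<bullet> e) *\<^sub>R \<phi> e)"
  have \<phi>C: "\<phi> e \<in> C" if "e \<in> Basis" for e using \<phi> that by (auto simp: bij_betw_def)
  have T\<phi>: "T x \<bullet> \<phi> e = x \<bullet> e" if e: "e \<in> Basis" for x e
  proof -
    have "T x \<bullet> \<phi> e = (\<Sum>i\<in>Basis. (x \<bullet> i) * (if i = e then 1 else 0))"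
      unfolding T_def inner_sum_left inner_scaleR_left
    proof (rule sum.cong[OF refl])
      fix i :: 'a assume "i \<in> Basis"
      then have "(\<phi> i = \<phi> e) = (i = e)"
        using \<phi> e by (auto simp: bij_betw_def inj_on_def)
      then show "(x \<bullet> i) * (\<phi> i \<bullet> \<phi> e) = (x \<bullet> i) * (if i = e then 1 else 0)"
        using orthonormal_basis_inner[OF C \<phi>C[OF \<open>i \<in> Basis\<close>] \<phi>C[OF e]] by simp
    qed
    then show ?thesis using e by (simp add: if_distrib cong: if_cong)
  qed
  have "orthogonal_transformation T"
    unfolding orthogonal_transformation_def
  proof (intro conjI allI)
    show "linear T"
      unfolding T_def by (rule linearI) (simp_all add: algebra_simps sum.distrib scaleR_sum_right)
    show "T v \<bullet> T w = v \<bullet> w" for v w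
    proof -
      have "T v \<bullet> T w = (\<Sum>e\<in>Basis. (w \<bullet> e) * (T v \<bullet> \<phi> e))"
        by (subst (2) T_def) (simp add: inner_sum_right)
      also have "\<dots> = v \<bullet> w"
        by (simp add: T\<phi> euclidean_inner[of v w] mult.commute)
      finally show ?thesis .
    qed
  qed
  then have TL: "distr lborel borel T = lborel" by (rule lborel_distr_orthogonal)
  have [measurable]: "T \<in> borel_measurable borel"
    unfolding T_def by measurable
  show ?thesis
  proof (rule PiM_eqI[OF fin])
    fix A :: "'a \<Rightarrow> real set" assume A: "\<And>i. i \<in> C \<Longrightarrow> A i \<in> sets lborel"
    let ?X = "{x :: 'a. \<forall>e\<in>Basis. x \<bullet> e \<in> A (\<phi> e)}"
    let ?Y = "{y :: 'a. \<forall>b\<in>C. y \<bullet> b \<in> A b}"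
    have X: "?X \<in> sets borel"
    proof -
      have "?X = (\<Inter>e\<in>Basis. (\<lambda>x. x \<bullet> e) -` A (\<phi> e) \<inter> space borel)" by auto
      also have "\<dots> \<in> sets borel"
        using A \<phi>C by (intro sets.finite_INT measurable_sets[of _ borel borel]) auto
      finally show ?thesis .
    qed
    have Y: "?Y \<in> sets borel"
    proof -
      have "C \<noteq> {}" using card by auto
      have "?Y = (\<Inter>e\<in>C. (\<lambda>x. x \<bullet> e) -` A e \<inter> space borel)" by auto
      also have "\<dots> \<in> sets borel"
        using A fin \<open>C \<noteq> {}\<close> by (intro sets.finite_INT measurable_sets[of _ borel borel]) auto
      finally show ?thesis .
    qed
    have "emeasure (distr lborel (\<Pi>\<^sub>M b\<in>C. lborel) (\<lambda>y. \<lambda>b\<in>C. y \<bullet> b)) (Pi\<^sub>E C A) =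
        emeasure lborel ((\<lambda>y. \<lambda>b\<in>C. y \<bullet> b) -` Pi\<^sub>E C A \<inter> space lborel)"
      using A fin by (intro emeasure_distr) (auto intro!: sets_PiM_I_finite)
    also have "(\<lambda>y. \<lambda>b\<in>C. y \<bullet> b) -` Pi\<^sub>E C A \<inter> space lborel = ?Y"
      by (auto simp: PiE_iff)
    \<comment> \<open>Pulling back along \<open>T\<close> turns the box \<open>?Y\<close> with edges
      along \<open>C\<close> into the axis-parallel box \<open>?X\<close>.\<close>
    also have "emeasure lborel ?Y = emeasure (distr lborel borel T) ?Y" using TL by simp
    also have "\<dots> = emeasure lborel ?X"
    proof -
      have "T -` ?Y = ?X"
        using \<phi> T\<phi> unfolding bij_betw_def by (auto simp flip: T\<phi>)
      then show ?thesis using Y by (simp add: emeasure_distr)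
    qed
    also have "\<dots> = emeasure (\<Pi>\<^sub>M b\<in>Basis. (lborel::real measure)) (\<Pi>\<^sub>E e\<in>Basis. A (\<phi> e))"
    proof -
      have "emeasure lborel ?X =
          emeasure (distr (\<Pi>\<^sub>M b\<in>Basis. lborel) borel (\<lambda>f. \<Sum>b\<in>Basis. f b *\<^sub>R b :: 'a)) ?X"
        by (simp flip: lborel_eq)
      also have "\<dots> = emeasure (\<Pi>\<^sub>M b\<in>Basis. (lborel::real measure))
          ((\<lambda>f. \<Sum>b\<in>Basis. f b *\<^sub>R b :: 'a) -` ?X \<inter> space (\<Pi>\<^sub>M b\<in>Basis. (lborel::real measure)))"
        using X by (intro emeasure_distr) auto
      also have "(\<lambda>f. \<Sum>b\<in>Basis. f b *\<^sub>R b :: 'a) -` ?X \<inter> space (\<Pi>\<^sub>M b\<in>Basis. (lborel::real measure))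
          = (\<Pi>\<^sub>E e\<in>Basis. A (\<phi> e))"
        by (auto simp: space_PiM PiE_iff inner_sum_left inner_Basis if_distrib cong: if_cong)
      finally show ?thesis .
    qed
    also have "\<dots> = (\<Prod>e\<in>Basis. emeasure lborel (A (\<phi> e)))"
      using A \<phi>C by (intro emeasure_PiM) auto
    also have "\<dots> = (\<Prod>b\<in>C. emeasure lborel (A b))"
      by (rule prod.reindex_bij_betw[OF \<phi>])
    finally show "emeasure (distr lborel (\<Pi>\<^sub>M b\<in>C. lborel) (\<lambda>y. \<lambda>b\<in>C. y \<bullet> b)) (Pi\<^sub>E C A) =
      (\<Prod>b\<in>C. emeasure lborel (A b))" .
  qed simp
qed

text \<open>An orthogonal projection onto the hyperplane with normal \<open>u\<close> when
  \<open>u\<close> is a unit vector. The formula is polynomial in both arguments, so joint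
  continuity holds without a condition on \<open>u\<close>.\<close>

definition hyperplane_proj :: "'a::euclidean_space \<Rightarrow> 'a \<Rightarrow> 'a" where
  "hyperplane_proj u y = y - (u \<bullet> y) *\<^sub>R u"

lemma inner_hyperplane_proj: "norm u = 1 \<Longrightarrow> u \<bullet> hyperplane_proj u y = 0"
  by (simp add: hyperplane_proj_def inner_diff_right dot_square_norm)

lemma continuous_hyperplane_proj [continuous_intros]:
  "continuous_on A f \<Longrightarrow> continuous_on A g \<Longrightarrow> continuous_on A (\<lambda>x. hyperplane_proj (f x) (g x))"
  unfolding hyperplane_proj_def by (intro continuous_intros)

lemma tendsto_hyperplane_proj [tendsto_intros]:
  "(f \<longlongrightarrow> u) F \<Longrightarrow> (g \<longlongrightarrow> y) F \<Longrightarrow> ((\<lambda>x. hyperplane_proj (f x) (g x)) \<longlongrightarrow> hyperplane_proj u y) F"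
  unfolding hyperplane_proj_def by (intro tendsto_intros)

lemma measurable_hyperplane_proj [measurable]: "hyperplane_proj u \<in> borel_measurable borel"
  unfolding hyperplane_proj_def[abs_def] by measurable

lemma hyperplane_proj_scaleR: "hyperplane_proj u (c *\<^sub>R y) = c *\<^sub>R hyperplane_proj u y"
  by (simp add: hyperplane_proj_def algebra_simps)

lemma norm_hyperplane_proj_le:
  assumes "norm u = 1" shows "norm (hyperplane_proj u y) \<le> norm y"
proof -
  have "(norm (hyperplane_proj u y))\<^sup>2 = (norm y)\<^sup>2 - (u \<bullet> y)\<^sup>2"
    using assms unfolding norm_eq_1 power2_norm_eq_inner
    by (simp add: hyperplane_proj_def inner_diff_left inner_diff_right inner_commute
        power2_eq_square algebra_simps)
  then have "(norm (hyperplane_proj u y))\<^sup>2 \<le> (norm y)\<^sup>2" by simp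
  then show ?thesis by (rule power2_le_imp_le) simp
qed

lemma nn_integral_lborel_orthonormal_basis:
  fixes C :: "'a::euclidean_space set"
  assumes C: "orthonormal_basis UNIV C" and g[measurable]: "g \<in> borel_measurable borel"
  shows "(\<integral>\<^sup>+ y. g y \<partial>lborel) = (\<integral>\<^sup>+ f. g (\<Sum>b\<in>C. f b *\<^sub>R b) \<partial>(\<Pi>\<^sub>M b\<in>C. (lborel :: real measure)))"
proof -
  have fin: "finite C" using orthonormal_basis_UNIV_card[OF C] by simp
  have "(\<integral>\<^sup>+ f. g (\<Sum>b\<in>C. f b *\<^sub>R b) \<partial>(\<Pi>\<^sub>M b\<in>C. (lborel :: real measure))) =
     (\<integral>\<^sup>+ f. g (\<Sum>b\<in>C. f b *\<^sub>R b) \<partial>distr lborel (\<Pi>\<^sub>M b\<in>C. (lborel :: real measure)) (\<lambda>y. \<lambda>b\<in>C. y \<bullet> b))"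
    by (simp add: distr_lborel_orthonormal_coordinates[OF C])
  also have "\<dots> = (\<integral>\<^sup>+ y. g (\<Sum>b\<in>C. (y \<bullet> b) *\<^sub>R b) \<partial>lborel)"
    by (subst nn_integral_distr) (auto intro!: nn_integral_cong)
  also have "\<dots> = (\<integral>\<^sup>+ y. g y \<partial>lborel)"
    by (simp add: orthonormal_basis_expand[OF C _ fin])
  finally show ?thesis by simp
qed

text \<open>
  Thickening the hyperplane to a slab of width one describes the measures on all the hyperplanes
  through one and the same measure on the ambient space.
\<close>

lemma subspace_lborel_hyperplane:
  fixes u :: "'a::euclidean_space"
  assumes u: "norm u = 1"
  shows "subspace_lborel {x. u \<bullet> x = 0} =
    distr (density lborel (\<lambda>y. ennreal (indicator {0..1} (u \<bullet> y)))) borel (hyperplane_proj u)"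
proof (rule measure_eqI)
  let ?H = "{x. u \<bullet> x = 0}"
  define B where "B = (SOME B. orthonormal_basis ?H B)"
  have B: "orthonormal_basis ?H B"
    unfolding B_def using someI_ex[OF orthonormal_basis_exists[OF subspace_hyperplane]] by blast
  have BH: "u \<bullet> b = 0" "b \<bullet> u = 0" if "b \<in> B" for b
    using B that span_base[of b B] by (auto simp: orthonormal_basis_def inner_commute)
  have uB: "u \<notin> B" using BH[of u] u by auto
  \<comment> \<open>\<open>B\<close> is the basis hidden in the definition of
    \<open>subspace_lborel\<close>; with the normal \<open>u\<close> it spans everything, since
    \<open>y\<close> is its projection plus a multiple of \<open>u\<close>.\<close>
  have C: "orthonormal_basis UNIV (insert u B)"
    unfolding orthonormal_basis_def
  proof (intro conjI)
    show "pairwise orthogonal (insert u B)"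
      using B BH by (auto simp: orthonormal_basis_def pairwise_insert orthogonal_def)
    show "\<forall>b\<in>insert u B. norm b = 1" using B u by (auto simp: orthonormal_basis_def)
    have "y \<in> span (insert u B)" for y
    proof -
      have "hyperplane_proj u y \<in> span B"
        using B inner_hyperplane_proj[OF u] by (auto simp: orthonormal_basis_def)
      then have "hyperplane_proj u y + (u \<bullet> y) *\<^sub>R u \<in> span (insert u B)"
        by (intro span_add span_scale) (auto intro: span_base span_mono[THEN subsetD, rotated])
      then show ?thesis by (simp add: hyperplane_proj_def)
    qed
    then show "span (insert u B) = UNIV" by auto
  qed
  then have fin: "finite B" using orthonormal_basis_UNIV_card(1)[of "insert u B"] by simp
  interpret product_sigma_finite "\<lambda>_::'a. lborel :: real measure" by standard
  have S: "subspace_lborel ?H = distr (\<Pi>\<^sub>M b\<in>B. (lborel :: real measure)) borel (\<lambda>f. \<Sum>b\<in>B. f b *\<^sub>R b)"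
    by (simp add: subspace_lborel_def B_def Let_def)
  show "sets (subspace_lborel ?H) =
     sets (distr (density lborel (\<lambda>y. ennreal (indicator {0..1} (u \<bullet> y)))) borel (hyperplane_proj u))"
    by (simp add: S)
  fix A :: "'a set" assume "A \<in> sets (subspace_lborel ?H)"
  then have A[measurable]: "A \<in> sets borel" by (simp add: S)
  let ?g = "\<lambda>y. ennreal (indicator {0..1} (u \<bullet> y)) * indicator A (hyperplane_proj u y)"
  have "emeasure (distr (density lborel (\<lambda>y. ennreal (indicator {0..1} (u \<bullet> y)))) borel (hyperplane_proj u)) A
     = (\<integral>\<^sup>+ y. indicator A y \<partial>distr (density lborel (\<lambda>y. ennreal (indicator {0..1} (u \<bullet> y)))) borel (hyperplane_proj u))"
    by simp
  also have "\<dots> = (\<integral>\<^sup>+ y. ?g y \<partial>lborel)"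
    by (subst nn_integral_distr) (simp_all add: nn_integral_density)
  also have "\<dots> = (\<integral>\<^sup>+ f. ?g (\<Sum>b\<in>insert u B. f b *\<^sub>R b) \<partial>(\<Pi>\<^sub>M b\<in>insert u B. (lborel :: real measure)))"
    by (rule nn_integral_lborel_orthonormal_basis[OF C]) simp
  also have "\<dots> = (\<integral>\<^sup>+ f. (\<integral>\<^sup>+ t. ?g (\<Sum>b\<in>insert u B. (f(u := t)) b *\<^sub>R b) \<partial>lborel)
      \<partial>(\<Pi>\<^sub>M b\<in>B. (lborel :: real measure)))"
    by (rule product_nn_integral_insert[OF fin uB]) measurable
  \<comment> \<open>The projection discards the coordinate \<open>t\<close> along \<open>u\<close>,
    and the slab condition becomes \<open>t \<in> {0..1}\<close>. The integrand therefore splits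
    into a product, and the integral over \<open>t\<close> is 1.\<close>
  also have "\<dots> = (\<integral>\<^sup>+ f. (\<integral>\<^sup>+ t. indicator A (\<Sum>b\<in>B. f b *\<^sub>R b) * indicator {0..1} (t::real) \<partial>lborel)
      \<partial>(\<Pi>\<^sub>M b\<in>B. (lborel :: real measure)))"
  proof (intro nn_integral_cong)
    fix f :: "'a \<Rightarrow> real" and t :: real
    have *: "(\<Sum>b\<in>insert u B. (f(u := t)) b *\<^sub>R b) = t *\<^sub>R u + (\<Sum>b\<in>B. f b *\<^sub>R b)"
    proof -
      have "(\<Sum>b\<in>B. (f(u := t)) b *\<^sub>R b) = (\<Sum>b\<in>B. f b *\<^sub>R b)"
        using uB by (intro sum.cong) auto
      then show ?thesis using fin uB by simp
    qed
    have "u \<bullet> (\<Sum>b\<in>B. f b *\<^sub>R b) = 0" by (simp add: inner_sum_right BH)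
    then show "?g (\<Sum>b\<in>insert u B. (f(u := t)) b *\<^sub>R b) =
        indicator A (\<Sum>b\<in>B. f b *\<^sub>R b) * indicator {0..1} t"
      unfolding * using u
      by (simp add: hyperplane_proj_def inner_add_right dot_square_norm indicator_def)
  qed
  also have "\<dots> = (\<integral>\<^sup>+ f. indicator A (\<Sum>b\<in>B. f b *\<^sub>R b) \<partial>(\<Pi>\<^sub>M b\<in>B. (lborel :: real measure)))"
    by (simp add: nn_integral_cmult_indicator)
  also have "\<dots> = (\<integral>\<^sup>+ y. indicator A y \<partial>subspace_lborel ?H)"
    unfolding S by (subst nn_integral_distr) simp_all
  also have "\<dots> = emeasure (subspace_lborel ?H) A"
    by (simp add: S)
  finally show "emeasure (subspace_lborel ?H) A =
     emeasure (distr (density lborel (\<lambda>y. ennreal (indicator {0..1} (u \<bullet> y)))) borel (hyperplane_proj u)) A"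
    by simp
qed

lemma sets_subspace_lborel [simp, measurable_cong]: "sets (subspace_lborel H) = sets borel"
  by (simp add: subspace_lborel_def Let_def)

lemma space_subspace_lborel [simp]: "space (subspace_lborel H) = UNIV"
  by (simp add: subspace_lborel_def Let_def)

lemma integral_subspace_lborel_hyperplane:
  fixes u :: "'a::euclidean_space" and g :: "'a \<Rightarrow> 'b::{banach,second_countable_topology}"
  assumes u: "norm u = 1" and [measurable]: "g \<in> borel_measurable borel"
  shows "integral\<^sup>L (subspace_lborel {x. u \<bullet> x = 0}) g =
    (LINT y|lborel. indicator {0..1} (u \<bullet> y) *\<^sub>R g (hyperplane_proj u y))"
  unfolding subspace_lborel_hyperplane[OF u]
  by (simp add: integral_distr integral_density)

section \<open>Exceptional null sets and limits of integrals over hyperplanes\<close>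

lemma AE_hyperplane_proj_notin_frontier:
  fixes u :: "'a::euclidean_space"
  assumes "convex S" "0 \<in> interior S"
  shows "AE y in lborel. hyperplane_proj u y \<notin> frontier S"
proof -
  let ?N = "{y. hyperplane_proj u y \<in> frontier S}"
  have cl: "closed ?N"
    using continuous_closed_preimage[OF _ closed_UNIV frontier_closed, of "hyperplane_proj u" S]
    by (simp add: continuous_intros vimage_def)
  have "negligible ?N"
  proof (rule starlike_negligible_strong[OF cl, of 0])
    \<comment> \<open>The projection commutes with scaling, so the starlikeness criterion reduces to
      convexity: shrinking a point of the closure of \<open>S\<close> towards the interior point 0
      lands in the interior, off the frontier.\<close>
    fix c :: real and x assume c: "0 \<le> c" "c < 1" and x: "0 + x \<in> ?N"
    have "hyperplane_proj u x - (1 - c) *\<^sub>R (hyperplane_proj u x - 0) \<in> interior S"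
      using x c assms by (intro mem_interior_closure_convex_shrink) (auto simp: frontier_def)
    then have "hyperplane_proj u (c *\<^sub>R x) \<in> interior S"
      by (simp add: hyperplane_proj_scaleR algebra_simps)
    then show "0 + c *\<^sub>R x \<notin> ?N" by (simp add: frontier_def)
  qed
  moreover have "?N \<in> sets lborel" using cl by simp
  ultimately have "?N \<in> null_sets lborel"
    by (simp add: negligible_iff_null_sets null_sets_completion_iff)
  then show ?thesis by (rule AE_I') auto
qed

lemma AE_inner_neq:
  fixes u :: "'a::euclidean_space"
  assumes "u \<noteq> 0"
  shows "AE y in lborel. u \<bullet> y \<noteq> c"
proof -
  have "closed {y. u \<bullet> y = c}" by (rule closed_hyperplane)
  then have "{y. u \<bullet> y = c} \<in> sets lborel" by simp
  moreover have "negligible {y. u \<bullet> y = c}" using assms by (simp add: negligible_hyperplane)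
  ultimately have "{y. u \<bullet> y = c} \<in> null_sets lborel"
    by (simp add: negligible_iff_null_sets null_sets_completion_iff)
  then show ?thesis by (rule AE_I') auto
qed

text \<open>The integrand may vary with \<open>n\<close> because the support function of a section
  depends on the hyperplane. Convergence is required along the projections of a fixed
  \<open>y\<close>, since a point of one hyperplane need not lie on the next.\<close>

lemma integral_hyperplane_tendsto:
  fixes u :: "'a::euclidean_space" and g :: "'a \<Rightarrow> 'b::{banach,second_countable_topology}"
  assumes un: "\<And>n. norm (un n) = 1" and u: "norm u = 1" and lim: "un \<longlonglongrightarrow> u"
    and gn[measurable]: "\<And>n. gn n \<in> borel_measurable borel" and g[measurable]: "g \<in> borel_measurable borel"
    and bound: "\<And>n z. norm (gn n z) \<le> b * indicator (cball 0 r) z"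
    and conv: "AE y in lborel. (\<lambda>n. gn n (hyperplane_proj (un n) y)) \<longlonglongrightarrow> g (hyperplane_proj u y)"
  shows "(\<lambda>n. integral\<^sup>L (subspace_lborel {x. un n \<bullet> x = 0}) (gn n))
    \<longlonglongrightarrow> integral\<^sup>L (subspace_lborel {x. u \<bullet> x = 0}) g"
proof -
  have u0: "u \<noteq> 0" using u by auto
  show ?thesis
    unfolding integral_subspace_lborel_hyperplane[OF u g] integral_subspace_lborel_hyperplane[OF un gn]
  \<comment> \<open>A point of the slab exceeds its projection in norm by at most 1, hence the
    radius \<open>r + 1\<close>. The absolute value appears because \<open>b\<close> has no assumed
    sign.\<close>
  proof (rule integral_dominated_convergence[where w = "\<lambda>y. \<bar>b\<bar> * indicator (cball 0 (r + 1)) y"])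
    show "integrable lborel (\<lambda>y::'a. \<bar>b\<bar> * indicator (cball 0 (r + 1)) y)"
      by (intro integrable_mult_right integrable_real_indicator emeasure_bounded_finite) auto
    show "AE y in lborel. norm (indicator {0..1} (un n \<bullet> y) *\<^sub>R gn n (hyperplane_proj (un n) y))
      \<le> \<bar>b\<bar> * indicator (cball 0 (r + 1)) y" for n
    proof (intro AE_I2)
      fix y :: 'a
      have *: "norm y \<le> r + 1" if "0 \<le> un n \<bullet> y" "un n \<bullet> y \<le> 1" "norm (hyperplane_proj (un n) y) \<le> r"
      proof -
        have "y = hyperplane_proj (un n) y + (un n \<bullet> y) *\<^sub>R un n" by (simp add: hyperplane_proj_def)
        then have "norm y \<le> norm (hyperplane_proj (un n) y) + norm ((un n \<bullet> y) *\<^sub>R un n)"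
          by (metis norm_triangle_ineq)
        then show ?thesis using that un by simp
      qed
      show "norm (indicator {0..1} (un n \<bullet> y) *\<^sub>R gn n (hyperplane_proj (un n) y))
        \<le> \<bar>b\<bar> * indicator (cball 0 (r + 1)) y"
        using * bound[of n "hyperplane_proj (un n) y"]
        by (cases "norm (hyperplane_proj (un n) y) \<le> r") (auto simp: indicator_def split: if_splits)
    qed
    show "AE y in lborel. (\<lambda>n. indicator {0..1} (un n \<bullet> y) *\<^sub>R gn n (hyperplane_proj (un n) y))
       \<longlonglongrightarrow> indicator {0..1} (u \<bullet> y) *\<^sub>R g (hyperplane_proj u y)"
      using conv AE_inner_neq[OF u0, of 0] AE_inner_neq[OF u0, of 1]
    proof eventually_elim
      case (elim y)
      \<comment> \<open>The slab indicator jumps only where \<open>u \<bullet> y\<close> is 0 or 1,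
        that is, on two hyperplanes, which are null.\<close>
      have "isCont (indicator {0..1} :: real \<Rightarrow> real) (u \<bullet> y)"
        using u elim by (subst isCont_indicator) (auto simp: frontier_def interior_atLeastAtMost_real)
      then have "(\<lambda>n. indicator {0..1} (un n \<bullet> y) :: real) \<longlonglongrightarrow> indicator {0..1} (u \<bullet> y)"
        by (rule isCont_tendsto_compose) (intro tendsto_intros lim)
      then show ?case using elim by (intro tendsto_intros)
    qed
  qed measurable
qed

subsection \<open>Support functions of sections\<close>

lemma support_function_upper:
  assumes "bounded C" "x \<in> C"
  shows "x \<bullet> v \<le> support_function C v"
  unfolding support_function_def
proof (rule cSUP_upper[OF assms(2)])
  obtain r where "norm x \<le> r" if "x \<in> C" for x using assms(1) by (auto simp: bounded_iff)
  then have "x \<bullet> v \<le> r * norm v" if "x \<in> C" for x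
    using that by (meson norm_cauchy_schwarz order_trans mult_right_mono norm_ge_zero)
  then show "bdd_above ((\<lambda>x. x \<bullet> v) ` C)" by (auto simp: bdd_above_def)
qed

lemma support_function_least:
  "C \<noteq> {} \<Longrightarrow> (\<And>x. x \<in> C \<Longrightarrow> x \<bullet> v \<le> b) \<Longrightarrow> support_function C v \<le> b"
  unfolding support_function_def by (rule cSUP_least)

lemma abs_support_function_le:
  assumes r: "C \<subseteq> cball 0 r" and 0: "0 \<in> C"
  shows "\<bar>support_function C v\<bar> \<le> r * norm v"
proof -
  have "x \<bullet> v \<le> r * norm v" if "x \<in> C" for x
  proof -
    have "x \<bullet> v \<le> norm x * norm v" by (rule norm_cauchy_schwarz)
    also have "\<dots> \<le> r * norm v" using that r by (intro mult_right_mono) auto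
    finally show ?thesis .
  qed
  then have "support_function C v \<le> r * norm v" using 0 by (intro support_function_least) auto
  moreover have "0 \<le> support_function C v"
    using support_function_upper[OF _ 0, of v] bounded_subset[OF bounded_cball r] by simp
  ultimately show ?thesis by simp
qed

lemma support_function_lipschitz:
  assumes r: "C \<subseteq> cball 0 r" and 0: "0 \<in> C"
  shows "\<bar>support_function C v - support_function C w\<bar> \<le> r * norm (v - w)"
proof -
  have bdd: "bounded C" using r bounded_subset bounded_cball by blast
  have *: "support_function C v \<le> support_function C w + r * norm (v - w)" for v w
  proof (rule support_function_least)
    fix x assume x: "x \<in> C"
    have "x \<bullet> v = x \<bullet> w + x \<bullet> (v - w)" by (simp add: inner_diff_right)
    also have "x \<bullet> (v - w) \<le> norm x * norm (v - w)" by (rule norm_cauchy_schwarz)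
    also have "\<dots> \<le> r * norm (v - w)" using x r by (intro mult_right_mono) auto
    also have "x \<bullet> w \<le> support_function C w" by (rule support_function_upper[OF bdd x])
    finally show "x \<bullet> v \<le> support_function C w + r * norm (v - w)" by simp
  qed (use 0 in auto)
  show ?thesis using *[of v w] *[of w v] by (simp add: norm_minus_commute abs_le_iff)
qed

text \<open>A point of the section by \<open>w\<close> is moved into the section by \<open>u\<close>
  by projecting and then shrinking. With \<open>d = R * norm (u - w)\<close>, the projection costs
  \<open>d * norm v\<close> and the shrinking \<open>d / r * R * norm v\<close>; their sum is the
  error term. For two unit normals, exchanging their roles gives the reverse estimate.\<close>

lemma support_function_section_le:
  fixes K :: "'a::euclidean_space set"
  assumes "convex K" and r: "0 < r" "cball 0 r \<subseteq> K" and R: "K \<subseteq> cball 0 R" and u: "norm u = 1"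
  shows "support_function (K \<inter> {x. w \<bullet> x = 0}) v
    \<le> support_function (K \<inter> {x. u \<bullet> x = 0}) v + R * (R / r + 1) * norm (u - w) * norm v"
proof (rule support_function_least)
  have 0: "0 \<in> K" using r by auto
  have R0: "0 \<le> R" using 0 R by auto
  show "K \<inter> {x. w \<bullet> x = 0} \<noteq> {}" using 0 by auto
  fix x assume x: "x \<in> K \<inter> {x. w \<bullet> x = 0}"
  define h where "h = support_function (K \<inter> {x. u \<bullet> x = 0}) v"
  \<comment> \<open>Bounds the distance from \<open>x\<close> to the hyperplane normal to
    \<open>u\<close>: as \<open>w \<bullet> x = 0\<close>, that distance is the absolute value of
    \<open>(u - w) \<bullet> x\<close>.\<close>
  define d where "d = R * norm (u - w)"
  define p where "p = hyperplane_proj u x"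
  have d0: "0 \<le> d" using R0 by (simp add: d_def)
  have xR: "norm x \<le> R" using x R by auto
  have hR: "h \<le> R * norm v"
    using abs_support_function_le[OF le_infI1[OF R], of "{x. u \<bullet> x = 0}" v] 0 by (simp add: h_def)
  have px: "norm (p - x) \<le> d"
  proof -
    have "norm (p - x) = \<bar>u \<bullet> x\<bar>" by (simp add: p_def hyperplane_proj_def u)
    also have "u \<bullet> x = (u - w) \<bullet> x" using x by (simp add: inner_diff_left)
    also have "\<bar>(u - w) \<bullet> x\<bar> \<le> norm (u - w) * norm x" by (rule Cauchy_Schwarz_ineq2)
    also have "\<dots> \<le> norm (u - w) * R" by (intro mult_left_mono xR) simp
    finally show ?thesis by (simp add: d_def mult.commute)
  qed
  txt \<open>The projection \<open>p\<close> of \<open>x\<close> may leave \<open>K\<close>, but only by \<open>d\<close>, so shrinking brings it back.\<close>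
  have "(r / (r + d)) *\<^sub>R p \<in> K"
  proof (cases "d = 0")
    case True
    then show ?thesis using px x r by simp
  next
    case False
    then have d: "0 < d" using d0 by simp
    \<comment> \<open>Rescaled by \<open>r / d\<close>, the displacement \<open>p - x\<close> lies
      in the ball contained in \<open>K\<close>. Mixing it with \<open>x\<close> in the weights
      \<open>d / (r + d)\<close> and \<open>r / (r + d)\<close> gives exactly the shrunk
      \<open>p\<close>.\<close>
    have "norm ((r / d) *\<^sub>R (p - x)) \<le> r"
      using mult_left_mono[OF px, of "r / d"] d r by simp
    then have "(r / d) *\<^sub>R (p - x) \<in> K" using r by auto
    moreover have "r / (r + d) + d / (r + d) = 1"
      using r d by (simp flip: add_divide_distrib)
    ultimately have "(r / (r + d)) *\<^sub>R x + (d / (r + d)) *\<^sub>R ((r / d) *\<^sub>R (p - x)) \<in> K"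
      using x r d by (intro convexD[OF \<open>convex K\<close>]) auto
    moreover have "(d / (r + d)) *\<^sub>R ((r / d) *\<^sub>R (p - x)) = (r / (r + d)) *\<^sub>R (p - x)"
      using d by simp
    ultimately have "(r / (r + d)) *\<^sub>R x + (r / (r + d)) *\<^sub>R (p - x) \<in> K" by argo
    then show ?thesis by (simp flip: scaleR_add_right)
  qed
  moreover have "u \<bullet> p = 0" unfolding p_def by (rule inner_hyperplane_proj[OF u])
  ultimately have "((r / (r + d)) *\<^sub>R p) \<bullet> v \<le> h"
    unfolding h_def using bounded_subset[OF bounded_cball R]
    by (intro support_function_upper) (auto intro: bounded_subset)
  \<comment> \<open>Undoing the shrinking multiplies \<open>h\<close> by
    \<open>1 + d / r\<close>.\<close>
  then have "p \<bullet> v \<le> h + d / r * h"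
    using r d0 by (simp add: field_simps)
  also have "\<dots> \<le> h + d / r * (R * norm v)"
    using r d0 hR by (intro add_left_mono mult_left_mono) auto
  finally have "p \<bullet> v \<le> h + d / r * (R * norm v)" .
  moreover have "x \<bullet> v - p \<bullet> v \<le> d * norm v"
  proof -
    have "x \<bullet> v - p \<bullet> v = (x - p) \<bullet> v" by (simp add: inner_diff_left)
    also have "\<dots> \<le> norm (x - p) * norm v" by (rule norm_cauchy_schwarz)
    also have "\<dots> \<le> d * norm v" using px by (intro mult_right_mono) (auto simp: norm_minus_commute)
    finally show ?thesis .
  qed
  ultimately have "x \<bullet> v \<le> h + (d / r * (R * norm v) + d * norm v)" by simp
  also have "d / r * (R * norm v) + d * norm v = R * (R / r + 1) * norm (u - w) * norm v"
    by (simp add: d_def algebra_simps)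
  finally show "x \<bullet> v \<le> support_function (K \<inter> {x. u \<bullet> x = 0}) v + R * (R / r + 1) * norm (u - w) * norm v"
    by (simp add: h_def)
qed

text \<open>Convergence is joint in hyperplane and direction: in the Steiner integrand the direction
  is the normalized projection of a fixed point, so it moves together with the hyperplane.\<close>

lemma tendsto_support_function_section:
  fixes K :: "'a::euclidean_space set"
  assumes K: "convex K" "bounded K" "0 \<in> interior K"
    and un: "\<And>n. norm (un n) = 1" and u: "norm u = 1" and lim: "un \<longlonglongrightarrow> u" "vn \<longlonglongrightarrow> v"
  shows "(\<lambda>n. support_function (K \<inter> {x. un n \<bullet> x = 0}) (vn n))
    \<longlonglongrightarrow> support_function (K \<inter> {x. u \<bullet> x = 0}) v"
proof -
  obtain r where r: "0 < r" "cball 0 r \<subseteq> K" using K(3) mem_interior_cball by blast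
  obtain R where R: "K \<subseteq> cball 0 R" using K(2) unfolding bounded_iff by (metis mem_cball_0 subsetI)
  let ?h = "\<lambda>u v. support_function (K \<inter> {x. u \<bullet> x = 0}) v"
  let ?c = "R * (R / r + 1)"
  have 0: "0 \<in> K" using r by auto
  have "(\<lambda>n. ?h (un n) (vn n) - ?h u v) \<longlonglongrightarrow> 0"
  proof (rule Lim_null_comparison)
    show "\<forall>\<^sub>F n in sequentially. norm (?h (un n) (vn n) - ?h u v)
      \<le> ?c * norm (un n - u) * norm (vn n) + R * norm (vn n - v)"
    proof (rule always_eventually, rule allI)
      fix n
      have "\<bar>?h (un n) (vn n) - ?h u (vn n)\<bar> \<le> ?c * norm (un n - u) * norm (vn n)"
        using support_function_section_le[OF K(1) r R un[of n], of u "vn n"]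
          support_function_section_le[OF K(1) r R u, of "un n" "vn n"]
        by (simp add: abs_le_iff norm_minus_commute)
      moreover have "\<bar>?h u (vn n) - ?h u v\<bar> \<le> R * norm (vn n - v)"
        using R 0 by (intro support_function_lipschitz) auto
      ultimately show "norm (?h (un n) (vn n) - ?h u v)
        \<le> ?c * norm (un n - u) * norm (vn n) + R * norm (vn n - v)" by simp
    qed
    have "(\<lambda>n. ?c * norm (un n - u) * norm (vn n) + R * norm (vn n - v))
       \<longlonglongrightarrow> ?c * norm (u - u) * norm v + R * norm (v - v)"
      by (intro tendsto_intros lim)
    then show "(\<lambda>n. ?c * norm (un n - u) * norm (vn n) + R * norm (vn n - v)) \<longlonglongrightarrow> 0" by simp
  qed
  then show ?thesis by (simp add: LIM_zero_iff)
qed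

lemma borel_measurable_support_function:
  fixes C :: "'a::euclidean_space set"
  assumes "C \<subseteq> cball 0 r" "0 \<in> C"
  shows "support_function C \<in> borel_measurable borel"
proof (rule borel_measurable_continuous_onI)
  have "0 \<le> r" using assms by auto
  then have "r-lipschitz_on UNIV (support_function C)"
    using support_function_lipschitz[OF assms] by (auto simp: lipschitz_on_def dist_norm)
  then show "continuous_on UNIV (support_function C)" by (rule lipschitz_on_continuous_on)
qed

subsection \<open>Continuity of centroids and Steiner points\<close>

lemma indicator_hyperplane_proj_tendsto:
  fixes u :: "'a::euclidean_space"
  assumes "hyperplane_proj u y \<notin> frontier K" "un \<longlonglongrightarrow> u"
  shows "(\<lambda>n. indicator K (hyperplane_proj (un n) y) :: real) \<longlonglongrightarrow> indicator K (hyperplane_proj u y)"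
proof (rule isCont_tendsto_compose[where g = "indicator K"])
  show "isCont (indicator K :: 'a \<Rightarrow> real) (hyperplane_proj u y)"
    using assms by (simp add: isCont_indicator)
qed (intro tendsto_intros assms)

text \<open>Allows the indicator of \<open>K\<close> to replace that of the section, so that the
  integrand for the volume or the moment no longer varies with \<open>u\<close>.\<close>

lemma AE_subspace_lborel_hyperplane:
  assumes "norm u = 1"
  shows "AE z in subspace_lborel {x. u \<bullet> x = 0}. u \<bullet> z = 0"
  unfolding subspace_lborel_hyperplane[OF assms]
  by (subst AE_distr_iff) (auto simp: inner_hyperplane_proj[OF assms])

lemma measure_section_eq:
  fixes K :: "'a::euclidean_space set"
  assumes u: "norm u = 1" and K: "compact K"
  shows "measure (subspace_lborel {x. u \<bullet> x = 0}) (K \<inter> {x. u \<bullet> x = 0}) =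
    (LINT z|subspace_lborel {x. u \<bullet> x = 0}. indicator K z)"
proof -
  have [measurable]: "K \<in> sets borel" using K by (simp add: borel_compact)
  have [measurable]: "{x. u \<bullet> x = 0} \<in> sets borel" by (simp add: closed_hyperplane)
  have "measure (subspace_lborel {x. u \<bullet> x = 0}) (K \<inter> {x. u \<bullet> x = 0}) =
     (LINT z|subspace_lborel {x. u \<bullet> x = 0}. indicator (K \<inter> {x. u \<bullet> x = 0}) z)"
    by simp
  also have "\<dots> = (LINT z|subspace_lborel {x. u \<bullet> x = 0}. indicator K z)"
  proof (rule integral_cong_AE)
    show "AE z in subspace_lborel {x. u \<bullet> x = 0}.
        (indicator (K \<inter> {x. u \<bullet> x = 0}) z :: real) = indicator K z"
      using AE_subspace_lborel_hyperplane[OF u] by eventually_elim (simp add: indicator_def)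
  qed measurable
  finally show ?thesis .
qed

lemma section_centroid_eq:
  fixes K :: "'a::euclidean_space set"
  assumes u: "norm u = 1" and K: "compact K"
  shows "section_centroid K {x. u \<bullet> x = 0} =
    (1 / (LINT z|subspace_lborel {x. u \<bullet> x = 0}. indicator K z)) *\<^sub>R
    (LINT z|subspace_lborel {x. u \<bullet> x = 0}. indicator K z *\<^sub>R z)"
proof -
  have [measurable]: "K \<in> sets borel" using K by (simp add: borel_compact)
  have [measurable]: "{x. u \<bullet> x = 0} \<in> sets borel" by (simp add: closed_hyperplane)
  have "(LINT z:K \<inter> {x. u \<bullet> x = 0}|subspace_lborel {x. u \<bullet> x = 0}. z) =
     (LINT z|subspace_lborel {x. u \<bullet> x = 0}. indicator K z *\<^sub>R z)"
    unfolding set_lebesgue_integral_def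
  proof (rule integral_cong_AE)
    show "AE z in subspace_lborel {x. u \<bullet> x = 0}.
        indicator (K \<inter> {x. u \<bullet> x = 0}) z *\<^sub>R z = indicator K z *\<^sub>R z"
      using AE_subspace_lborel_hyperplane[OF u] by eventually_elim (simp add: indicator_def)
  qed measurable
  then show ?thesis
    by (simp add: section_centroid_def center_of_mass_def measure_section_eq[OF assms])
qed

text \<open>Keeps the denominator of the centroid away from zero in the limit. The slab over the
  section contains a small ball touching the hyperplane from one side.\<close>

lemma integral_section_pos:
  fixes K :: "'a::euclidean_space set"
  assumes u: "norm u = 1" and K: "compact K" "0 \<in> interior K"
  shows "0 < (LINT z|subspace_lborel {x. u \<bullet> x = 0}. (indicator K z :: real))"
proof -
  have [measurable]: "K \<in> sets borel" using K by (simp add: borel_compact)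
  obtain r where r: "0 < r" "cball 0 r \<subseteq> K" using K(2) mem_interior_cball by blast
  obtain R where R: "K \<subseteq> cball 0 R" using compact_imp_bounded[OF K(1)] unfolding bounded_iff by (metis mem_cball_0 subsetI)
  \<comment> \<open>The ball of radius \<open>s / 2\<close> about \<open>a\<close> touches the
    hyperplane at 0. There \<open>u \<bullet> y\<close> stays between 0 and
    \<open>s \<le> 1\<close>, and \<open>norm y < s \<le> r\<close>, so the projection remains in
    \<open>K\<close>.\<close>
  define s where "s = min 1 r"
  define a where "a = (s / 2) *\<^sub>R u"
  have s: "0 < s" "s \<le> 1" "s \<le> r" using r by (auto simp: s_def)
  let ?f = "\<lambda>y. indicator {0..1} (u \<bullet> y) * (indicator K (hyperplane_proj u y) :: real)"
  \<comment> \<open>A non-integrable function has Bochner integral 0, so a lower bound by a smaller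
    function is available only once integrability is known.\<close>
  have int: "integrable lborel ?f"
  proof (rule Bochner_Integration.integrable_bound[where f = "indicator (cball 0 (R + 1)) :: 'a \<Rightarrow> real"])
    show "integrable lborel (indicator (cball 0 (R + 1)) :: 'a \<Rightarrow> real)"
      by (intro integrable_real_indicator emeasure_bounded_finite) auto
    have "norm y \<le> R + 1" if "0 \<le> u \<bullet> y" "u \<bullet> y \<le> 1" "hyperplane_proj u y \<in> K" for y
    proof -
      have "y = hyperplane_proj u y + (u \<bullet> y) *\<^sub>R u" by (simp add: hyperplane_proj_def)
      then have "norm y \<le> norm (hyperplane_proj u y) + norm ((u \<bullet> y) *\<^sub>R u)"
        by (metis norm_triangle_ineq)
      then show ?thesis using that u R by auto
    qed
    then show "AE y in lborel. norm (?f y) \<le> norm (indicator (cball 0 (R + 1)) y :: real)"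
      by (intro AE_I2) (auto simp: indicator_def)
  qed measurable
  have "0 < measure lborel (ball a (s / 2))"
    using s by (simp add: content_ball_pos)
  also have "\<dots> = (LINT y|lborel. indicator (ball a (s / 2)) y)" by simp
  also have "\<dots> \<le> (LINT y|lborel. ?f y)"
  proof (rule integral_mono[OF _ int])
    show "integrable lborel (indicator (ball a (s / 2)) :: 'a \<Rightarrow> real)"
      by (intro integrable_real_indicator emeasure_bounded_finite) auto
    fix y :: 'a
    have "?f y = 1" if y: "norm (y - a) < s / 2"
    proof -
      have "\<bar>u \<bullet> (y - a)\<bar> \<le> norm (y - a)" using Cauchy_Schwarz_ineq2[of u "y - a"] u by simp
      moreover have "u \<bullet> (y - a) = u \<bullet> y - s / 2"
        using u by (simp add: a_def inner_diff_right dot_square_norm)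
      ultimately have "0 \<le> u \<bullet> y" "u \<bullet> y \<le> 1" using y s by auto
      moreover have "norm y \<le> norm (y - a) + norm a" by (metis diff_add_cancel norm_triangle_ineq)
      then have "norm (hyperplane_proj u y) \<le> r"
        using norm_hyperplane_proj_le[OF u, of y] y s u by (simp add: a_def)
      then have "hyperplane_proj u y \<in> K" using r by auto
      ultimately show ?thesis by simp
    qed
    then show "indicator (ball a (s / 2)) y \<le> ?f y"
      by (cases "norm (y - a) < s / 2") (auto simp: indicator_def dist_norm norm_minus_commute)
  qed
  also have "\<dots> = (LINT z|subspace_lborel {x. u \<bullet> x = 0}. (indicator K z :: real))"
    by (subst integral_subspace_lborel_hyperplane[OF u]) simp_all
  finally show ?thesis .
qed

lemma continuous_on_section_centroid:
  fixes K :: "'a::euclidean_space set"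
  assumes K: "convex K" "compact K" "0 \<in> interior K"
  shows "continuous_on (sphere 0 1) (\<lambda>u. section_centroid K {x. u \<bullet> x = 0})"
  unfolding continuous_on_sequentially
proof (intro ballI allI impI, elim conjE)
  fix u and un :: "nat \<Rightarrow> 'a" assume "u \<in> sphere 0 1" "\<forall>n. un n \<in> sphere 0 1" and lim: "un \<longlonglongrightarrow> u"
  then have u: "norm u = 1" and un: "norm (un n) = 1" for n by auto
  have [measurable]: "K \<in> sets borel" using K by (simp add: borel_compact)
  obtain R where R: "K \<subseteq> cball 0 R" using compact_imp_bounded[OF K(2)] unfolding bounded_iff by (metis mem_cball_0 subsetI)
  have AE: "AE y in lborel. hyperplane_proj u y \<notin> frontier K"
    by (rule AE_hyperplane_proj_notin_frontier[OF K(1,3)])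
  have 1: "(\<lambda>n. (LINT z|subspace_lborel {x. un n \<bullet> x = 0}. indicator K z :: real))
    \<longlonglongrightarrow> (LINT z|subspace_lborel {x. u \<bullet> x = 0}. indicator K z)"
  proof (rule integral_hyperplane_tendsto[OF un u lim])
    show "AE y in lborel. (\<lambda>n. indicator K (hyperplane_proj (un n) y) :: real)
      \<longlonglongrightarrow> indicator K (hyperplane_proj u y)"
      using AE by eventually_elim (rule indicator_hyperplane_proj_tendsto[OF _ lim])
    show "norm (indicator K z :: real) \<le> 1 * indicator (cball 0 R) z" for z
      using R by (auto simp: indicator_def)
  qed measurable
  have 2: "(\<lambda>n. (LINT z|subspace_lborel {x. un n \<bullet> x = 0}. indicator K z *\<^sub>R z))
    \<longlonglongrightarrow> (LINT z|subspace_lborel {x. u \<bullet> x = 0}. indicator K z *\<^sub>R z)"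
  proof (rule integral_hyperplane_tendsto[OF un u lim])
    show "AE y in lborel. (\<lambda>n. indicator K (hyperplane_proj (un n) y) *\<^sub>R hyperplane_proj (un n) y)
      \<longlonglongrightarrow> indicator K (hyperplane_proj u y) *\<^sub>R hyperplane_proj u y"
      using AE by eventually_elim (intro tendsto_intros indicator_hyperplane_proj_tendsto lim)
    show "norm (indicator K z *\<^sub>R z) \<le> R * indicator (cball 0 R) z" for z
      using R order_trans[OF norm_ge_zero[of z], of R] by (auto simp: indicator_def)
  qed measurable
  show "((\<lambda>u. section_centroid K {x. u \<bullet> x = 0}) \<circ> un) \<longlonglongrightarrow> section_centroid K {x. u \<bullet> x = 0}"
    unfolding o_def section_centroid_eq[OF u K(2)] section_centroid_eq[OF un K(2)]
    using integral_section_pos[OF u K(2,3)] by (intro tendsto_intros 1 2) simp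
qed

section \<open>Steiner points of sections\<close>

text \<open>Turns an integral over the unit sphere into one over the punctured unit ball of the
  hyperplane, where the slab formula applies.\<close>

lemma integral_sphere_measure:
  fixes g :: "'a::euclidean_space \<Rightarrow> 'b::{banach,second_countable_topology}"
  assumes [measurable]: "g \<in> borel_measurable borel"
  shows "(LINT u|sphere_measure H. g u) =
    real (dim H) *\<^sub>R (LINT z|subspace_lborel H. indicator (cball 0 1 - {0}) z *\<^sub>R g (sgn z))"
proof -
  let ?M = "distr (restrict_space (subspace_lborel H) (cball 0 1 - {0})) borel sgn"
  have m: "sgn \<in> restrict_space (subspace_lborel H) (cball 0 1 - {0}) \<rightarrow>\<^sub>M borel"
    by (rule measurable_restrict_space1) measurable
  have "sphere_measure H = density ?M (\<lambda>_. ennreal (real (dim H)))"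
    unfolding sphere_measure_def
    by (rule measure_eqI) (simp_all add: emeasure_density_const ennreal_of_nat_eq_real_of_nat)
  then have "(LINT u|sphere_measure H. g u) = (LINT u|?M. real (dim H) *\<^sub>R g u)"
    by (simp add: integral_density)
  also have "\<dots> = real (dim H) *\<^sub>R (LINT z|restrict_space (subspace_lborel H) (cball 0 1 - {0}). g (sgn z))"
    by (simp add: integral_distr[OF m])
  also have "\<dots> = real (dim H) *\<^sub>R (LINT z|subspace_lborel H. indicator (cball 0 1 - {0}) z *\<^sub>R g (sgn z))"
    by (subst integral_restrict_space) simp_all
  finally show ?thesis .
qed

lemma continuous_on_section_steiner:
  fixes K :: "'a::euclidean_space set"
  assumes K: "convex K" "compact K" "0 \<in> interior K"
  shows "continuous_on (sphere 0 1) (\<lambda>u. section_steiner K {x. u \<bullet> x = 0})"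
proof (cases "DIM('a) = 1")
  \<comment> \<open>On a line the only linear hyperplane is \<open>{0}\<close>, so
    \<open>steiner_point\<close> takes its degenerate branch and the map is constant.\<close>
  case True
  have "section_steiner K {x. u \<bullet> x = 0} = (THE x. x \<in> K \<inter> {0})" if "u \<in> sphere 0 1" for u
  proof -
    have d: "dim {x. u \<bullet> x = 0} = 0" using that True by (subst dim_hyperplane) auto
    then have "{x. u \<bullet> x = 0} = {0}" by (auto simp: dim_eq_0)
    then show ?thesis using d by (simp add: section_steiner_def steiner_point_def)
  qed
  then show ?thesis
    by (rule continuous_on_eq[OF continuous_on_const, OF sym])
next
  case False
  define d where "d = DIM('a) - 1"
  have d: "0 < d" using False DIM_positive[where 'a = 'a] unfolding d_def by linarith
  obtain R where R: "K \<subseteq> cball 0 R" using compact_imp_bounded[OF K(2)] unfolding bounded_iff by (metis mem_cball_0 subsetI)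
  have K0: "0 \<in> K" using K interior_subset by blast
  then have R0: "0 \<le> R" using R by auto
  define h where "h = (\<lambda>u. support_function (K \<inter> {x. u \<bullet> x = 0}))"
  \<comment> \<open>The origin need not be removed from the ball: \<open>sgn 0 = 0\<close> makes
    \<open>g\<close> vanish there. What remains is the indicator of a convex set with 0 in its
    interior, as the frontier lemma demands.\<close>
  define g where "g = (\<lambda>u z. indicator (cball 0 1) z *\<^sub>R h u (sgn z) *\<^sub>R sgn z)"
  have h[measurable]: "h u \<in> borel_measurable borel" for u
    unfolding h_def using R K0 by (intro borel_measurable_support_function[of _ R]) auto
  have g: "g u \<in> borel_measurable borel" for u
    unfolding g_def
    by (intro borel_measurable_scaleR borel_measurable_indicator borel_measurable_sgn
        measurable_compose[OF borel_measurable_sgn h]) simp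
  have eq: "section_steiner K {x. u \<bullet> x = 0} =
      (1 / unit_ball_vol (real d)) *\<^sub>R real d *\<^sub>R (LINT z|subspace_lborel {x. u \<bullet> x = 0}. g u z)"
    if "norm u = 1" for u
  proof -
    have dim: "dim {x. u \<bullet> x = 0} = d" using that unfolding d_def by (subst dim_hyperplane) auto
    have "(LINT z|subspace_lborel {x. u \<bullet> x = 0}. indicator (cball 0 1 - {0}) z *\<^sub>R h u (sgn z) *\<^sub>R sgn z) =
      (LINT z|subspace_lborel {x. u \<bullet> x = 0}. g u z)"
      by (intro Bochner_Integration.integral_cong) (auto simp: g_def indicator_def)
    moreover have "(LINT v|sphere_measure {x. u \<bullet> x = 0}. h u v *\<^sub>R v) = real d *\<^sub>R
      (LINT z|subspace_lborel {x. u \<bullet> x = 0}. indicator (cball 0 1 - {0}) z *\<^sub>R h u (sgn z) *\<^sub>R sgn z)"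
      using integral_sphere_measure[of "\<lambda>v. h u v *\<^sub>R v" "{x. u \<bullet> x = 0}"] h[of u]
      unfolding dim by (simp add: borel_measurable_scaleR)
    ultimately show ?thesis
      using d unfolding section_steiner_def steiner_point_def dim h_def by simp
  qed
  show ?thesis
    unfolding continuous_on_sequentially
  proof (intro ballI allI impI, elim conjE)
    fix u and un :: "nat \<Rightarrow> 'a" assume "u \<in> sphere 0 1" "\<forall>n. un n \<in> sphere 0 1" and lim: "un \<longlonglongrightarrow> u"
    then have u: "norm u = 1" and un: "norm (un n) = 1" for n by auto
    \<comment> \<open>\<open>sgn\<close> is discontinuous at 0. The projection vanishes only on the
      line spanned by \<open>u\<close>, which is null because the dimension is now at least
      2.\<close>
    have AE0: "AE y in lborel. hyperplane_proj u y \<noteq> 0"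
    proof -
      have "dim {y. hyperplane_proj u y = 0} \<le> dim (span {u})"
      proof (rule dim_subset)
        show "{y. hyperplane_proj u y = 0} \<subseteq> span {u}"
          by (auto simp: hyperplane_proj_def span_singleton)
      qed
      also have "\<dots> \<le> 1" using dim_le_card'[of "{u}"] by simp
      finally have "negligible {y. hyperplane_proj u y = 0}"
        using d by (intro negligible_lowdim) (auto simp: d_def)
      moreover have "{y. hyperplane_proj u y = 0} \<in> sets lborel" by measurable
      ultimately have "{y. hyperplane_proj u y = 0} \<in> null_sets lborel"
        by (simp add: negligible_iff_null_sets null_sets_completion_iff)
      then show ?thesis by (rule AE_I') auto
    qed
    have "(\<lambda>n. (LINT z|subspace_lborel {x. un n \<bullet> x = 0}. g (un n) z))
      \<longlonglongrightarrow> (LINT z|subspace_lborel {x. u \<bullet> x = 0}. g u z)"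
    proof (rule integral_hyperplane_tendsto[OF un u lim g g])
      show "norm (g (un n) z) \<le> R * indicator (cball 0 1) z" for n z
      proof -
        have "\<bar>h (un n) (sgn z)\<bar> \<le> R * norm (sgn z)"
          unfolding h_def using R K0 by (intro abs_support_function_le) auto
        also have "\<dots> \<le> R * 1" using R0 by (intro mult_left_mono) (auto simp: norm_sgn)
        finally have "\<bar>h (un n) (sgn z)\<bar> * norm (sgn z) \<le> R * 1"
          using R0 by (intro mult_mono) (auto simp: norm_sgn)
        then show ?thesis by (auto simp: g_def indicator_def)
      qed
      \<comment> \<open>Here the frontier to avoid is that of the unit ball: \<open>K\<close> enters
        only through \<open>h\<close>, which converges without exceptional points.\<close>
      have "AE y in lborel. hyperplane_proj u y \<notin> frontier (cball 0 1)"
        by (rule AE_hyperplane_proj_notin_frontier) auto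
      with AE0 show "AE y in lborel. (\<lambda>n. g (un n) (hyperplane_proj (un n) y)) \<longlonglongrightarrow> g u (hyperplane_proj u y)"
      proof eventually_elim
        case (elim y)
        have "(\<lambda>n. sgn (hyperplane_proj (un n) y)) \<longlonglongrightarrow> sgn (hyperplane_proj u y)"
          using elim(1) by (intro tendsto_intros lim)
        then show ?case
          unfolding g_def h_def using elim K compact_imp_bounded
          by (intro tendsto_intros indicator_hyperplane_proj_tendsto lim
              tendsto_support_function_section un u) auto
      qed
    qed
    then show "((\<lambda>u. section_steiner K {x. u \<bullet> x = 0}) \<circ> un) \<longlonglongrightarrow> section_steiner K {x. u \<bullet> x = 0}"
      unfolding o_def eq[OF u] eq[OF un] by (intro tendsto_intros)
  qed
qed

section \<open>Passage to projective space\<close>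

lemma orthogonal_comp_span_singleton: "orthogonal_comp (span {x}) = {y. x \<bullet> y = 0}"
  using span_base[of x "{x}"]
  by (auto simp: orthogonal_comp_def orthogonal_def span_singleton)

text \<open>By the quotient property, continuity on nonzero vectors suffices, and \<open>sgn\<close>
  reduces it to the sphere. Antipodal points give the same hyperplane, so \<open>F\<close> respects
  the identification automatically.\<close>

lemma continuous_map_projective_space_hyperplane:
  fixes F :: "'a::euclidean_space set \<Rightarrow> 'b::topological_space"
  assumes "continuous_on (sphere 0 1) (\<lambda>u. F {x. u \<bullet> x = 0})"
  shows "continuous_map projective_space euclidean (\<lambda>L. F (orthogonal_comp L))"
proof (rule continuous_compose_quotient_map[OF quotient_map_projective_space])
  have "continuous_on (- {0}) (\<lambda>v::'a. F {x. sgn v \<bullet> x = 0})"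
    by (rule continuous_on_compose2[OF assms]) (auto simp: sphere_def norm_sgn intro!: continuous_intros)
  moreover have "F {x. sgn v \<bullet> x = 0} = F {x. v \<bullet> x = 0}" if "v \<noteq> 0" for v :: 'a
    using that by (simp add: sgn_div_norm)
  ultimately have "continuous_on (- {0}) (\<lambda>v::'a. F {x. v \<bullet> x = 0})"
    by (rule continuous_on_eq) simp
  then show "continuous_map (top_of_set (- {0})) euclidean ((\<lambda>L. F (orthogonal_comp L)) \<circ> (\<lambda>x. span {x}))"
    by (simp add: o_def orthogonal_comp_span_singleton)
qed

lemma multiplicity_hyperplanes:
  fixes F :: "'a::euclidean_space set \<Rightarrow> 'b"
  assumes "admits_multiplicity projective_space (\<lambda>L. F (orthogonal_comp L)) k"
  shows "\<exists>H :: nat \<Rightarrow> 'a set. inj_on H {1..k} \<and> (\<forall>i\<in>{1..k}. linear_hyperplane (H i)) \<and>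
    (\<forall>i\<in>{1..k}. \<forall>j\<in>{1..k}. F (H i) = F (H j))"
proof -
  obtain L :: "nat \<Rightarrow> 'a set" where L: "L ` {1..k} \<subseteq> topspace projective_space" "inj_on L {1..k}"
    "\<forall>i\<in>{1..k}. \<forall>j\<in>{1..k}. F (orthogonal_comp (L i)) = F (orthogonal_comp (L j))"
    using assms by (auto simp: admits_multiplicity_def)
  have span: "\<exists>x. x \<noteq> 0 \<and> L i = span {x}" if "i \<in> {1..k}" for i
  proof -
    have "L i \<in> (\<lambda>x. span {x}) ` (- {0})"
      using L(1) that unfolding topspace_projective_space by blast
    then show ?thesis by auto
  qed
  \<comment> \<open>Taking the orthogonal complement twice recovers the line, so distinct lines give
    distinct hyperplanes.\<close>
  have "inj_on (\<lambda>i. orthogonal_comp (L i)) {1..k}"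
    by (rule inj_onI) (metis L(2) inj_onD orthogonal_comp_self span subspace_span)
  moreover have "linear_hyperplane (orthogonal_comp (L i))" if i: "i \<in> {1..k}" for i
  proof -
    obtain x where "x \<noteq> 0" "L i = span {x}" using span[OF i] by blast
    then show ?thesis
      unfolding linear_hyperplane_def hyperplane_def
      by (simp add: orthogonal_comp_span_singleton) blast
  qed
  ultimately show ?thesis using L(3) by (intro exI[of _ "\<lambda>i. orthogonal_comp (L i)"] conjI) blast+
qed

theorem theorem1p14:
  fixes K :: "(real ^ 'm) set"
  assumes "convex_body K" and "0 \<in> interior K"
  shows
    "(\<exists>f :: (real ^ 'm) set \<Rightarrow> real ^ 'm. continuous_map projective_space euclidean f \<and>
        (\<forall>k\<ge>2. admits_multiplicity projective_space f k \<longrightarrow>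
          (\<exists>H :: nat \<Rightarrow> (real ^ 'm) set. inj_on H {1..k} \<and>
            (\<forall>i\<in>{1..k}. linear_hyperplane (H i)) \<and>
            (\<forall>i\<in>{1..k}. \<forall>j\<in>{1..k}. section_centroid K (H i) = section_centroid K (H j))))) \<and>
     (\<exists>f :: (real ^ 'm) set \<Rightarrow> real ^ 'm. continuous_map projective_space euclidean f \<and>
        (\<forall>k\<ge>2. admits_multiplicity projective_space f k \<longrightarrow>
          (\<exists>H :: nat \<Rightarrow> (real ^ 'm) set. inj_on H {1..k} \<and>
            (\<forall>i\<in>{1..k}. linear_hyperplane (H i)) \<and>
            (\<forall>i\<in>{1..k}. \<forall>j\<in>{1..k}. section_steiner K (H i) = section_steiner K (H j)))))"
proof -
  have K: "convex K" "compact K" using assms(1) by (auto simp: convex_body_def)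
  show ?thesis
    by (intro conjI exI[of _ "\<lambda>L. section_centroid K (orthogonal_comp L)"]
        exI[of _ "\<lambda>L. section_steiner K (orthogonal_comp L)"] allI impI
        continuous_map_projective_space_hyperplane continuous_on_section_centroid
        continuous_on_section_steiner multiplicity_hyperplanes K assms(2))
qed

end
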